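(* For every $f\in\mathcal{S}$ one has $$|S'_f(0)|\leq \frac{64}{5}\sqrt{3}=22.17025\ldots.$$
   Context: Let $\mathbb{D}=\{z\in\mathbb{C}:|z|<1\}$, and let $\mathcal{A}$ be the family of functions $f$ analytic in $\mathbb{D}$ with $f(0)=0$ and $f'(0)=1$. $\mathcal{S}$ is the subclass of those $f\in\mathcal{A}$ that are univalent (injective) in $\mathbb{D}$. For a locally univalent function $f$ in $\mathbb{D}$, the Schwarzian derivative is $$S_f(z)=\left(\frac{f''(z)}{f'(z)}\right)'-\frac12\left(\frac{f''(z)}{f'(z)}\right)^2,$$ and $S'_f(0)$ denotes the value at $0$ of the derivative of the function $S_f$. *)

theory Defs
  imports "HOL-Complex_Analysis.Complex_Analysis"
begin

definition class_A :: "(complex \<Rightarrow> complex) set" where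
  "class_A = {f. f holomorphic_on ball 0 1 \<and> f 0 = 0 \<and> deriv f 0 = 1}"

definition class_S :: "(complex \<Rightarrow> complex) set" where
  "class_S = {f \<in> class_A. inj_on f (ball 0 1)}"

(* Meaningful at points near which f is holomorphic with nonvanishing derivative. *)
definition schwarzian :: "(complex \<Rightarrow> complex) \<Rightarrow> complex \<Rightarrow> complex" where
  "schwarzian f z =
     deriv (\<lambda>w. deriv (deriv f) w / deriv f w) z - 1 / 2 * (deriv (deriv f) z / deriv f z)\<^sup>2"

end

theory Submission
  imports Defs
begin

text \<open>
  Write \<open>1 / f z = q z / z = 1/z + b\<^sub>0 + b\<^sub>1 z + b\<^sub>2 z^2 + \<dots>\<close>. A computation with the Leibniz rule gives
  \<open>S\<^sub>f' 0 = - 24 b\<^sub>2\<close>, and Gronwall's area theorem gives \<open>2 \<bar>b\<^sub>2\<bar>^2 \<le> 1\<close>, hence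
  \<open>\<bar>S\<^sub>f' 0\<bar> \<le> 12 \<surd>2 < 17\<close>, which is stronger than the claim.

  For the area theorem, \<open>1 / f\<close> maps the circle of radius \<open>e\<close> to a curve that is, up to \<open>O(e^2)\<close>, an
  ellipse which the real-linear map \<open>w \<mapsto> w - b\<^sub>1 e^2 cnj w\<close> turns into a circle of radius \<open>1/e\<close>. Points of
  the disc outside that circle are mapped into the ellipse: otherwise a line separates the image point from the
  curve, and the maximum principle applied to \<open>1 / (1/f - 1/f z\<^sub>0)\<close>, which vanishes at \<open>0\<close>, yields a contradiction.
  Comparing areas (the Jacobian is integrated in the coordinate \<open>log z\<close>, with Bessel's inequality on
  every circle) and letting \<open>e \<rightarrow> 0\<close> gives the bound.
\<close>

section \<open>Values of \<open>1 / f\<close> outside a small disc, by the maximum principle\<close>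

text \<open>No line strictly separates \<open>1 / f z0\<close> from the image of the circle under
  \<open>1 / f\<close>. With such a line, \<open>1 / (k * (1 / f z - 1 / f z0))\<close> would have
  negative real part on the circle and yet vanish at the centre.\<close>

lemma separation_outside_disc:
  fixes f :: "complex \<Rightarrow> complex"
  assumes hol: "f holomorphic_on ball 0 1" and f0: "f 0 = 0" and inj: "inj_on f (ball 0 1)"
    and e: "0 < e" "e < cmod z0" "cmod z0 < 1"
  shows "\<exists>z. cmod z = e \<and> 0 \<le> Re (k * (1 / f z - 1 / f z0))"
proof (rule ccontr)
  assume "\<not> ?thesis"
  then have neg: "Re (k * (1 / f z - 1 / f z0)) < 0" if "cmod z = e" for z
    using that not_le by blast
  have k: "k \<noteq> 0" using neg[of "of_real e"] e by auto
  have ne: "f z \<noteq> f z0" if "cmod z \<le> e" for z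
    using inj_onD[OF inj, of z z0] that e by auto
  have fz0: "f z0 \<noteq> 0" using ne[of 0] f0 e by auto
  have fnz: "f z \<noteq> 0" if "cmod z = e" for z
    using inj_onD[OF inj, of z 0] that e f0 by auto
  \<comment> \<open>The reciprocal with denominators cleared: the pole of \<open>1 / f\<close> at
    \<open>0\<close> becomes a zero of \<open>h\<close>, and injectivity keeps the denominator away
    from zero on the closed disc.\<close>
  define h where "h = (\<lambda>z. f z0 * f z / (k * (f z0 - f z)))"
  have sub: "cball 0 e \<subseteq> ball (0::complex) 1" using e by auto
  have ne': "k * (f z0 - f z) \<noteq> 0" if "z \<in> cball 0 e" for z
    using ne[of z] k that by auto
  have holh: "h holomorphic_on cball 0 e"
    unfolding h_def
    by (intro holomorphic_intros holomorphic_on_subset[OF hol sub] ne')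
  then have conth: "continuous_on (cball 0 e) h" by (rule holomorphic_on_imp_continuous_on)
  have hneg: "Re (h z) < 0" if "z \<in> sphere 0 e" for z
  proof -
    have ze: "cmod z = e" using that by auto
    define u where "u = k * (1 / f z - 1 / f z0)"
    have "h z = 1 / u"
      using k fz0 fnz[OF ze] ne[of z] ze unfolding h_def u_def by (simp add: field_simps)
    moreover have "Re u < 0" using neg[OF ze] by (simp add: u_def)
    moreover have "Re (1 / u) = Re u / (cmod u)\<^sup>2" by (simp add: Re_divide cmod_power2)
    moreover have "u \<noteq> 0" using \<open>Re u < 0\<close> by auto
    ultimately show ?thesis by (simp add: divide_neg_pos)
  qed
  have "continuous_on (sphere 0 e) (\<lambda>z. Re (h z))"
    by (intro continuous_intros continuous_on_subset[OF conth]) auto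
  moreover have "sphere (0::complex) e \<noteq> {}" using e by auto
  ultimately obtain w where w: "w \<in> sphere 0 e" "\<And>z. z \<in> sphere 0 e \<Longrightarrow> Re (h z) \<le> Re (h w)"
    using continuous_attains_sup[OF compact_sphere] by metis
  have "Re (h 0) \<le> Re (h w)"
    by (rule maximum_real_frontier[of h "cball 0 e"])
       (use e w holh conth in \<open>auto intro: holomorphic_on_subset\<close>)
  then show False using hneg[OF w(1)] by (simp add: h_def f0)
qed

text \<open>The condition \<open>cmod (L w) \<le> Q\<close> is convex in \<open>w\<close>, because
  \<open>L\<close> is real-affine. Hence it passes from the curve to every point that no line
  separates from the curve.\<close>

lemma ellipse_bound_outside_disc:
  fixes f :: "complex \<Rightarrow> complex"
  assumes hol: "f holomorphic_on ball 0 1" and f0: "f 0 = 0" and inj: "inj_on f (ball 0 1)"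
    and e: "0 < e" "e < cmod z0" "cmod z0 < 1"
    and bd: "\<And>z. cmod z = e \<Longrightarrow> cmod ((1 / f z - b) - c * cnj (1 / f z - b)) \<le> Q"
  shows "cmod ((1 / f z0 - b) - c * cnj (1 / f z0 - b)) \<le> Q"
proof (rule ccontr)
  define L where "L = (\<lambda>w. (w - b) - c * cnj (w - b))"
  define a where "a = L (1 / f z0)"
  assume "\<not> ?thesis"
  then have aQ: "cmod a > Q" by (simp add: a_def L_def)
  \<comment> \<open>The direction is the adjoint of \<open>d \<mapsto> d - c * cnj d\<close> applied
    to \<open>a\<close>, so that the real part becomes the inner product of \<open>a\<close> with
    \<open>L (1 / f z) - a\<close>.\<close>
  obtain z where z: "cmod z = e" "0 \<le> Re ((cnj a - a * cnj c) * (1 / f z - 1 / f z0))"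
    using separation_outside_disc[OF hol f0 inj e] by blast
  define d where "d = 1 / f z - 1 / f z0"
  have "L (1 / f z) - a = d - c * cnj d"
    by (simp add: a_def L_def d_def algebra_simps)
  moreover have "Re (cnj a * (d - c * cnj d)) = Re ((cnj a - a * cnj c) * d)"
    by (simp add: algebra_simps)
  ultimately have "Re (cnj a * (L (1 / f z) - a)) = Re ((cnj a - a * cnj c) * d)"
    by simp
  then have "0 \<le> Re (cnj a * (L (1 / f z) - a))" using z(2) by (simp add: d_def)
  moreover have sqa: "Re (cnj a * a) = (cmod a)\<^sup>2" by (simp add: cmod_power2) (simp add: power2_eq_square)
  ultimately have "(cmod a)\<^sup>2 \<le> Re (cnj a * L (1 / f z))"
    by (simp add: right_diff_distrib sqa del: times_complex.sel)
  also have "\<dots> \<le> cmod (cnj a * L (1 / f z))" by (rule complex_Re_le_cmod)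
  also have "\<dots> \<le> cmod a * Q"
    using bd[OF z(1)] by (simp add: norm_mult L_def mult_left_mono)
  finally have "cmod a * cmod a \<le> cmod a * Q" by (simp add: power2_eq_square)
  moreover have "0 \<le> Q" using bd[OF z(1)] norm_ge_zero order_trans by blast
  ultimately show False using aQ by (auto simp: mult_le_cancel_left)
qed

section \<open>Fourier integrals and Bessel's inequality on circles\<close>

text \<open>Cauchy's formula for a Taylor coefficient. Along the circle
  \<open>du = \<i> u dt\<close>, which cancels one of the \<open>n + 1\<close> factors in the
  denominator and the \<open>\<i>\<close> of the residue factor.\<close>

lemma circle_coeff_integral:
  fixes m :: "complex \<Rightarrow> complex" and r :: real
  assumes hol: "m holomorphic_on ball 0 1" and r: "0 < r" "r < 1"
  shows "((\<lambda>t. m (r * cis t) / (r * cis t) ^ n) has_integral 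
           2 * pi * ((deriv ^^ n) m 0 / fact n)) {0..2*pi}"
proof -
  have sub: "cball 0 r \<subseteq> ball (0::complex) 1" using r by auto
  have "((\<lambda>u. m u / (u - 0) ^ Suc n) has_contour_integral
          (2 * pi * \<i>) / fact n * (deriv ^^ n) m 0) (circlepath 0 r)"
    using r by (intro Cauchy_has_contour_integral_higher_derivative_circlepath)
      (auto intro!: holomorphic_on_imp_continuous_on holomorphic_on_subset[OF hol])
  then have "((\<lambda>t. m (0 + r * cis t) / (0 + r * cis t - 0) ^ Suc n * r * \<i> * cis t) has_integral
          (2 * pi * \<i>) / fact n * (deriv ^^ n) m 0) {0..2*pi}"
    unfolding circlepath_def by (subst (asm) has_contour_integral_part_circlepath_iff) auto
  from has_integral_mult_right[OF this, of "-\<i>"] show ?thesis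
    using r by (simp add: field_simps)
qed

lemma circle_monomial_integral:
  fixes r :: real
  assumes "0 < r" "r < 1" "n > 0"
  shows "((\<lambda>t. (r * cis t) ^ n) has_integral 0) {0..2*pi}"
proof -
  have "(\<lambda>z::complex. z ^ n) holomorphic_on ball 0 1" by (intro holomorphic_intros)
  from circle_coeff_integral[OF this assms(1,2), of 0] show ?thesis
    using assms(3) by (simp add: power_0_left)
qed

lemma cmod_add_sq: "(cmod (x + y))\<^sup>2 = (cmod x)\<^sup>2 + (cmod y)\<^sup>2 + 2 * Re (cnj x * y)"
  unfolding cmod_power2 by (simp add: power2_eq_square algebra_simps)

text \<open>Bessel's inequality for the frequencies \<open>0\<close> and \<open>n\<close> alone.
  Dropping the square of \<open>m - P\<close>, with \<open>P = A + B * z ^ n\<close>, leaves only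
  integrals that are linear in \<open>m\<close>, so no series expansion is required.\<close>

lemma circle_mean_square_ge:
  fixes m :: "complex \<Rightarrow> complex" and r :: real
  assumes hol: "m holomorphic_on ball 0 1" and r: "0 < r" "r < 1" and n: "n > 0"
  shows "2 * pi * ((cmod (m 0))\<^sup>2 + (cmod ((deriv ^^ n) m 0 / fact n))\<^sup>2 * r ^ (2 * n))
           \<le> integral {0..2*pi} (\<lambda>t. (cmod (m (r * cis t)))\<^sup>2)"
proof -
  define A where "A = m 0"
  define B where "B = (deriv ^^ n) m 0 / fact n"
  \<comment> \<open>On the circle \<open>Re (I t)\<close> equals
    \<open>(cmod m)\<^sup>2 - (cmod (m - P))\<^sup>2\<close>. The conjugate power of
    \<open>z\<close> is traded for \<open>r ^ (2*n) / z ^ n\<close>, so that each summand has a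
    known integral.\<close>
  define I where "I = (\<lambda>t. 2 * (cnj A * m (r * cis t) + cnj B * r ^ (2*n) * (m (r * cis t) / (r * cis t) ^ n))
       - ((cmod A)\<^sup>2 + (cmod B)\<^sup>2 * r ^ (2*n)) - 2 * (cnj A * B * (r * cis t) ^ n))"
  have i0: "((\<lambda>t. m (r * cis t)) has_integral 2 * pi * A) {0..2*pi}"
    using circle_coeff_integral[OF hol r, of 0] by (simp add: A_def)
  have "(I has_integral (2 * (cnj A * (2 * pi * A) + cnj B * r ^ (2*n) * (2 * pi * B))
       - (2*pi - 0) *\<^sub>R of_real ((cmod A)\<^sup>2 + (cmod B)\<^sup>2 * r ^ (2*n)) - 2 * (cnj A * B * 0))) {0..2*pi}"
    unfolding I_def using r n
    by (intro has_integral_diff has_integral_add has_integral_mult_right i0 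
         circle_coeff_integral[OF hol r, of n, folded B_def] circle_monomial_integral)
       (use has_integral_const_real[of _ 0 "2*pi"] in auto)
  also have "2 * (cnj A * (2 * pi * A) + cnj B * r ^ (2*n) * (2 * pi * B))
       - (2*pi - 0) *\<^sub>R of_real ((cmod A)\<^sup>2 + (cmod B)\<^sup>2 * r ^ (2*n)) - 2 * (cnj A * B * 0)
      = of_real (2 * pi * ((cmod A)\<^sup>2 + (cmod B)\<^sup>2 * r ^ (2*n)))"
    using complex_norm_square[of A] complex_norm_square[of B]
    by (simp add: algebra_simps scaleR_conv_of_real)
  finally have "(I has_integral of_real (2 * pi * ((cmod A)\<^sup>2 + (cmod B)\<^sup>2 * r ^ (2*n)))) {0..2*pi}" .
  from has_integral_linear[OF this bounded_linear_Re]
  have "((\<lambda>t. Re (I t)) has_integral 2 * pi * ((cmod A)\<^sup>2 + (cmod B)\<^sup>2 * r ^ (2*n))) {0..2*pi}"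
    by (simp add: o_def)
  moreover have "((\<lambda>t. (cmod (m (r * cis t)))\<^sup>2) has_integral
        integral {0..2*pi} (\<lambda>t. (cmod (m (r * cis t)))\<^sup>2)) {0..2*pi}"
  proof (intro integrable_integral integrable_continuous_interval continuous_intros)
    show "continuous_on {0..2*pi} (\<lambda>t. m (r * cis t))"
      using r by (intro continuous_on_compose2[OF holomorphic_on_imp_continuous_on[OF hol]])
        (auto intro!: continuous_intros simp: norm_mult)
  qed
  moreover have "Re (I t) \<le> (cmod (m (r * cis t)))\<^sup>2" for t
  proof -
    define z where "z = r * cis t"
    define P where "P = A + B * z ^ n"
    have z: "z \<noteq> 0" "cnj z * z = of_real (r\<^sup>2)" 
      using r by (auto simp: z_def power2_eq_square cis_cnj cis_mult mult_ac) 
    have zn: "cnj z ^ n = of_real r ^ (2*n) / z ^ n"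
    proof -
      have "(cnj z * z) ^ n = of_real r ^ (2*n)" by (simp add: z(2) power_mult)
      then show ?thesis using z(1) by (simp add: field_simps power_mult_distrib)
    qed
    have "cmod (B * z ^ n) = cmod B * r ^ n" using r by (simp add: z_def norm_mult norm_power)
    then have "(cmod (B * z ^ n))\<^sup>2 = (cmod B)\<^sup>2 * r ^ (2*n)"
      by (simp only: power_mult_distrib power_even_eq)
    then have P2: "(cmod P)\<^sup>2 = (cmod A)\<^sup>2 + (cmod B)\<^sup>2 * r ^ (2*n) + 2 * Re (cnj A * B * z ^ n)"
      unfolding P_def cmod_add_sq by (simp only: mult.assoc)
    have "Re (I t) = 2 * Re (m z * cnj P) - (cmod P)\<^sup>2"
    proof -
      have aux: "Re (2 * x - of_real y - 2 * w) = 2 * Re x - y - 2 * Re w" for x y w by simp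
      have "m z * cnj P = cnj A * m z + cnj B * r ^ (2*n) * (m z / z ^ n)"
        by (simp add: P_def zn distrib_left)
      then have "I t = 2 * (m z * cnj P) - of_real ((cmod A)\<^sup>2 + (cmod B)\<^sup>2 * r ^ (2*n)) - 2 * (cnj A * B * z ^ n)"
        by (simp add: I_def flip: z_def)
      then have "Re (I t) = 2 * Re (m z * cnj P) - ((cmod A)\<^sup>2 + (cmod B)\<^sup>2 * r ^ (2*n)) - 2 * Re (cnj A * B * z ^ n)"
        by (simp only: aux)
      then show ?thesis unfolding P2 by linarith
    qed
    also have "\<dots> = (cmod (m z))\<^sup>2 - (cmod (m z - P))\<^sup>2"
      unfolding cmod_power2 by (simp add: power2_eq_square algebra_simps)
    finally show ?thesis by (simp add: z_def)
  qed
  ultimately show ?thesis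
    unfolding A_def[symmetric] B_def[symmetric] by (rule has_integral_le) 
qed

section \<open>Area of the image of a rectangle\<close>

text \<open>Links the change of variables on \<open>real^2\<close> with iterated integration on
  \<open>real \<times> real\<close>. The coordinate identification maps boxes to boxes and keeps
  their content.\<close>

lemma has_integral_vec2_eq_prod:
  fixes f :: "real \<times> real \<Rightarrow> real"
  assumes "continuous_on (cbox (a, c) (b, d)) f"
  shows "((\<lambda>x. f (x $ 1, x $ 2)) has_integral integral (cbox (a, c) (b, d)) f) 
           (cbox (vector [a, c]) (vector [b, d] :: real^2))"
proof -
  define g where "g = (\<lambda>x::real^2. (x $ 1, x $ 2))"
  define h where "h = (\<lambda>p::real \<times> real. vector [fst p, snd p] :: real^2)"
  have hg: "h (g x) = x" and gh: "g (h p) = p" for x p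
    by (auto simp: h_def g_def vec_eq_iff forall_2)
  have gim: "g ` cbox u v = cbox (g u) (g v)" for u v
  proof (intro equalityI subsetI)
    fix p assume "p \<in> cbox (g u) (g v)"
    then have "h p \<in> cbox u v"
      by (auto simp: h_def g_def mem_box_cart forall_2 mem_box_componentwiseI cbox_Pair_eq)
    then show "p \<in> g ` cbox u v" using gh[of p] by (metis imageI)
  qed (auto simp: g_def mem_box_cart forall_2 cbox_Pair_eq)
  have him: "h ` cbox u v = cbox (h u) (h v)" for u v
  proof -
    have "cbox u v = g ` cbox (h u) (h v)" by (simp add: gim gh)
    then show ?thesis by (simp add: image_image hg)
  qed
  have cont: "measure lborel (g ` cbox u v) = 1 * measure lborel (cbox u v)" for u v
  proof -
    have "measure lborel (cbox u v) = (if cbox u v = {} then 0 else (v $ 1 - u $ 1) * (v $ 2 - u $ 2))"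
      by (simp add: content_cbox_if_cart UNIV_2)
    moreover have "measure lborel (cbox (g u) (g v)) = measure lborel (cbox (u $ 1) (v $ 1)) * measure lborel (cbox (u $ 2) (v $ 2))"
      by (simp add: g_def content_Pair)
    moreover have "cbox u v \<noteq> {} \<longleftrightarrow> (\<forall>i. u $ i \<le> v $ i)"
      by (auto simp: interval_eq_empty_cart not_less)
    \<comment> \<open>Empty boxes are split off, because the product of two negative side lengths is
      positive while the content is zero.\<close>
    then have "cbox u v = {} \<longleftrightarrow> v $ 1 < u $ 1 \<or> v $ 2 < u $ 2"
      unfolding forall_2 by linarith
    ultimately show ?thesis by (auto simp: gim content_cbox_if)
  qed
  have "(f has_integral integral (cbox (a, c) (b, d)) f) (cbox (a, c) (b, d))"
    using integrable_continuous[OF assms] by (rule integrable_integral)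
  then have "((\<lambda>x. f (g x)) has_integral (1 / 1) *\<^sub>R integral (cbox (a, c) (b, d)) f) (h ` cbox (a, c) (b, d))"
    by (intro has_integral_twiddle[where g = g and h = h])
       (use hg gh gim him cont in \<open>auto simp: g_def intro!: continuous_intros\<close>)
  then show ?thesis by (simp add: him) (simp add: g_def h_def)
qed

text \<open>The map \<open>w \<mapsto> w - k * cnj w\<close> has Jacobian
  \<open>1 - (cmod k)\<^sup>2\<close> and \<open>G\<close> has Jacobian
  \<open>(cmod (deriv G))\<^sup>2\<close>, so the left side is the area of a set inside a disc of
  radius \<open>Q\<close>. Injectivity is asked only on the open rectangle: in the application
  through \<open>exp\<close>, two opposite edges have the same image.\<close>

lemma area_le_if_twisted_image_in_cball:
  fixes G :: "complex \<Rightarrow> complex"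
  assumes hol: "G holomorphic_on S" and S: "open S"
    and sub: "\<And>s t. s \<in> {a..b} \<Longrightarrow> t \<in> {c..d} \<Longrightarrow> Complex s t \<in> S"
    and inj: "inj_on G {z. Re z \<in> {a<..<b} \<and> Im z \<in> {c<..<d}}"
    and k: "cmod k < 1"
    and Q: "\<And>s t. s \<in> {a<..<b} \<Longrightarrow> t \<in> {c<..<d} \<Longrightarrow> 
        cmod (G (Complex s t) - k * cnj (G (Complex s t)) - p) \<le> Q"
    and "0 \<le> Q"
  shows "(1 - (cmod k)\<^sup>2) * integral {a..b} (\<lambda>s. integral {c..d} (\<lambda>t. (cmod (deriv G (Complex s t)))\<^sup>2))
           \<le> pi * Q\<^sup>2"
proof -
  define V where "V = (\<lambda>z. vector [Re z, Im z] :: real^2)"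
  define C where "C = (\<lambda>x::real^2. Complex (x $ 1) (x $ 2))"
  define L where "L = (\<lambda>z. z - k * cnj z)"
  define B where "B = box (vector [a, c]) (vector [b, d] :: real^2)"
  define F where "F = (\<lambda>x. V (L (G (C x))))"
  define F' where "F' = (\<lambda>x h. V (L (deriv G (C x) * C h)))"
  define J where "J = (\<lambda>p::real \<times> real. (1 - (cmod k)\<^sup>2) * (cmod (deriv G (Complex (fst p) (snd p))))\<^sup>2)"
  have CB: "C x \<in> S" "Re (C x) \<in> {a<..<b} \<and> Im (C x) \<in> {c<..<d}" if "x \<in> B" for x
    using that sub by (auto simp: B_def C_def mem_box_cart forall_2)
  have linC: "bounded_linear C" 
    unfolding C_def by (intro linear_conv_bounded_linear[THEN iffD1] linearI) (auto simp: complex_eq_iff)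
  have linV: "bounded_linear V"
    unfolding V_def by (intro linear_conv_bounded_linear[THEN iffD1] linearI) (auto simp: vec_eq_iff forall_2)
  have linL: "bounded_linear L"
    unfolding L_def by (intro linear_conv_bounded_linear[THEN iffD1] linearI) (auto simp: algebra_simps scaleR_conv_of_real)
  have der: "(F has_derivative F' x) (at x within B)" if "x \<in> B" for x
  proof -
    have "(G has_derivative (*) (deriv G (C x))) (at (C x))"
      using holomorphic_derivI[OF hol S CB(1)[OF that]] by (simp add: has_field_derivative_def)
    then have "((\<lambda>x. G (C x)) has_derivative (\<lambda>h. deriv G (C x) * C h)) (at x)"
      by (rule has_derivative_compose[OF bounded_linear_imp_has_derivative[OF linC]])
    then have "((\<lambda>x. V (L (G (C x)))) has_derivative (\<lambda>h. V (L (deriv G (C x) * C h)))) (at x)"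
      by (intro bounded_linear.has_derivative[OF linV] bounded_linear.has_derivative[OF linL])
    then show ?thesis unfolding F_def F'_def by (rule has_derivative_at_withinI)
  qed
  have det: "det (matrix (F' x)) = J (x $ 1, x $ 2)" for x
  proof -
    have C1: "C (axis 1 1) = 1" and C2: "C (axis 2 1) = \<i>"
      by (simp_all add: C_def axis_def complex_eq_iff)
    obtain u1 u2 where u: "deriv G (C x) = Complex u1 u2" by (cases "deriv G (C x)")
    obtain k1 k2 where kk: "k = Complex k1 k2" by (cases k)
    show ?thesis
      using u by (simp add: det_2 matrix_def F'_def V_def C1 C2 L_def J_def kk cmod_power2)
        (simp add: C_def power2_eq_square algebra_simps)
  qed
  have injF: "inj_on F B"
  proof (rule inj_onI)
    fix x y assume xy: "x \<in> B" "y \<in> B" "F x = F y"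
    then have "L (G (C x)) = L (G (C y))"
      by (auto simp: F_def V_def vec_eq_iff forall_2 complex_eq_iff)
    define e where "e = G (C x) - G (C y)"
    \<comment> \<open>\<open>L\<close> has trivial kernel: taking moduli gives
      \<open>cmod e = cmod k * cmod e\<close> with \<open>cmod k < 1\<close>.\<close>
    have "e = k * cnj e" using \<open>L (G (C x)) = L (G (C y))\<close> by (simp add: e_def L_def algebra_simps)
    then have "cmod e = cmod k * cmod e" by (metis complex_mod_cnj norm_mult)
    then have "e = 0" using k by auto
    then have "C x = C y" using inj_onD[OF inj, of "C x" "C y"] CB xy by (auto simp: e_def)
    then show "x = y" by (auto simp: C_def vec_eq_iff forall_2)
  qed
  have contJ: "continuous_on (cbox (a, c) (b, d)) J"
  proof -
    have "continuous_on (cbox (a, c) (b, d)) (\<lambda>p. deriv G (Complex (fst p) (snd p)))"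
      by (rule continuous_on_compose2[OF holomorphic_on_imp_continuous_on[OF holomorphic_deriv[OF hol S]]])
         (auto intro!: continuous_intros simp: sub cbox_Pair_eq)
    then show ?thesis unfolding J_def by (intro continuous_intros)
  qed
  have Jnn: "0 \<le> J q" for q
    using k by (simp add: J_def power_le_one)
  have "((\<lambda>x. J (x $ 1, x $ 2)) has_integral integral (cbox (a, c) (b, d)) J) B"
    unfolding B_def has_integral_open_interval by (rule has_integral_vec2_eq_prod[OF contJ])
  then have "((\<lambda>x. \<bar>det (matrix (F' x))\<bar>) has_integral integral (cbox (a, c) (b, d)) J) B"
    by (simp add: det Jnn)
  then have meas: "F ` B \<in> lmeasurable" "measure lebesgue (F ` B) = integral (cbox (a, c) (b, d)) J"
    using has_measure_differentiable_image[OF _ der injF] by (auto simp: B_def)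
  have "F ` B \<subseteq> cball (V p) Q"
  proof clarsimp
    fix x assume "x \<in> B"
    then have "cmod (L (G (C x)) - p) \<le> Q"
      using Q[of "x $ 1" "x $ 2"] CB(2)[of x] by (auto simp: L_def C_def)
    moreover have "dist (V p) (F x) = cmod (L (G (C x)) - p)"
      by (simp add: dist_vec_def L2_set_def sum_2 F_def V_def dist_real_def cmod_def power2_commute)
    ultimately show "dist (V p) (F x) \<le> Q" by simp
  qed
  then have "measure lebesgue (F ` B) \<le> measure lebesgue (cball (V p) Q)"
    using meas by (intro measure_mono_fmeasurable) auto
  also have "\<dots> = pi * Q\<^sup>2"
    using content_cball[of Q "V p"] \<open>0 \<le> Q\<close> by (simp add: measure_completion unit_ball_vol_2)
  also have "measure lebesgue (F ` B)
      = (1 - (cmod k)\<^sup>2) * integral {a..b} (\<lambda>s. integral {c..d} (\<lambda>t. (cmod (deriv G (Complex s t)))\<^sup>2))"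
    unfolding meas integral_prod_continuous[OF contJ] by (simp add: J_def)
  finally show ?thesis .
qed

section \<open>The reciprocal of \<open>f\<close> and its link with the Schwarzian
  derivative\<close>

text \<open>The quotient \<open>f z / z\<close> has a removable singularity at \<open>0\<close> with
  value \<open>deriv f 0 = 1\<close>. By injectivity it has no zero in the disc, so \<open>q\<close>
  is its reciprocal.\<close>

lemma class_S_reciprocal:
  assumes "f \<in> class_S"
  obtains q where "q holomorphic_on ball 0 1" "q 0 = 1" "\<And>z. z \<in> ball 0 1 \<Longrightarrow> f z * q z = z"
proof
  have f: "f holomorphic_on ball 0 1" "f 0 = 0" "deriv f 0 = 1" "inj_on f (ball 0 1)"
    using assms by (auto simp: class_S_def class_A_def)
  define p where "p = (\<lambda>z. if z = 0 then deriv f 0 else (f z - f 0) / (z - 0))"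
  have p: "p holomorphic_on ball 0 1"
    unfolding p_def by (rule pole_lemma_open[OF f(1)]) auto
  have nz: "f z \<noteq> 0" if "z \<in> ball 0 1" "z \<noteq> 0" for z
    using inj_onD[OF f(4), of z 0] that f(2) by auto
  have "p z \<noteq> 0" if "z \<in> ball 0 1" for z
    using nz[OF that] f by (auto simp: p_def)
  then show "(\<lambda>z. 1 / p z) holomorphic_on ball 0 1" by (intro holomorphic_intros p)
  show "1 / p 0 = 1" by (simp add: p_def f)
  show "f z * (1 / p z) = z" if "z \<in> ball 0 1" for z
    using nz[OF that] by (auto simp: p_def f)
qed

text \<open>Differentiates the closed form \<open>f''' / f' - 3/2 (f'' / f')^2\<close>, which holds
  on all of the open set \<open>S\<close>, and then inserts \<open>f' = 1\<close> at
  \<open>z\<close>.\<close>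

lemma deriv_schwarzian:
  assumes hol: "f holomorphic_on S" and S: "open S" "z \<in> S" and nz: "\<And>w. w \<in> S \<Longrightarrow> deriv f w \<noteq> 0"
    and f1: "deriv f z = 1"
  shows "deriv (schwarzian f) z = (deriv ^^ 4) f z - 4 * (deriv ^^ 2) f z * (deriv ^^ 3) f z + 3 * (deriv ^^ 2) f z ^ 3"
proof -
  define D where "D = (\<lambda>i. (deriv ^^ i) f)"
  have D: "(D i has_field_derivative D (Suc i) w) (at w)" if "w \<in> S" for i w
    unfolding D_def using has_field_derivative_higher_deriv[OF hol S(1) that] .
  have D1: "deriv f = D 1" and D2: "deriv (deriv f) = D 2"
    by (simp_all add: D_def numeral_2_eq_2)
  have nz': "D 1 w \<noteq> 0" if "w \<in> S" for w using nz[OF that] by (simp add: D1)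
  have sch: "schwarzian f w = D 3 w / D 1 w - 3 / 2 * (D 2 w / D 1 w)\<^sup>2" if "w \<in> S" for w
  proof -
    have "((\<lambda>w. D 2 w / D 1 w) has_field_derivative (D 3 w * D 1 w - D 2 w * D 2 w) / (D 1 w * D 1 w)) (at w)"
      using D[OF that, of 1] D[OF that, of 2] nz'[OF that]
      by (intro DERIV_divide) (simp_all add: numeral_eq_Suc)
    then show ?thesis
      unfolding schwarzian_def D2 unfolding D1 using nz'[OF that]
      by (simp add: DERIV_imp_deriv field_simps power2_eq_square)
  qed
  have z1: "D 1 z = 1" using f1 by (simp add: D1)
  have "((\<lambda>w. D 3 w / D 1 w - 3 / 2 * (D 2 w / D 1 w)\<^sup>2) has_field_derivative
      D 4 z - 4 * D 2 z * D 3 z + 3 * D 2 z ^ 3) (at z)"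
    using D[OF S(2), of 1] D[OF S(2), of 2] D[OF S(2), of 3] z1
    by (auto intro!: derivative_eq_intros simp: numeral_eq_Suc) (simp add: field_simps)
  then have "(schwarzian f has_field_derivative D 4 z - 4 * D 2 z * D 3 z + 3 * D 2 z ^ 3) (at z)"
    by (rule has_field_derivative_transform_within_open[OF _ S]) (simp add: sch)
  then show ?thesis unfolding D_def by (rule DERIV_imp_deriv)
qed

text \<open>The Leibniz rule for \<open>f z * q z = z\<close> at orders 2, 3 and 4 expresses the
  derivatives of \<open>f\<close> at \<open>0\<close> by those of \<open>q\<close>; in the
  Schwarzian expression everything but the third derivative of \<open>q\<close> cancels. Since
  \<open>b\<^sub>2\<close> is that derivative divided by 6, the value is
  \<open>-24 b\<^sub>2\<close>.\<close>

lemma deriv_schwarzian_eq_reciprocal_coeff: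
  assumes f: "f \<in> class_S" and q: "q holomorphic_on ball 0 1" "q 0 = 1"
    and fq: "\<And>z. z \<in> ball 0 1 \<Longrightarrow> f z * q z = z"
  shows "deriv (schwarzian f) 0 = - 4 * (deriv ^^ 3) q 0"
proof -
  have hf: "f holomorphic_on ball 0 1" "f 0 = 0" "deriv f 0 = 1" "inj_on f (ball 0 1)"
    using f by (auto simp: class_S_def class_A_def)
  define a where "a = (\<lambda>i. (deriv ^^ i) f 0)"
  define c where "c = (\<lambda>i. (deriv ^^ i) q 0)"
  have leib: "(\<Sum>i = 0..n. of_nat (n choose i) * a i * c (n - i)) = 0" if "n \<ge> 2" for n
  proof -
    have "(deriv ^^ n) (\<lambda>w. f w * q w) 0 = (deriv ^^ n) (\<lambda>w. w) 0"
      by (rule higher_deriv_transform_within_open[of _ "ball 0 1"])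
         (use fq in \<open>auto intro!: holomorphic_intros hf q\<close>)
    also have "\<dots> = 0" using that by (simp add: higher_deriv_ident)
    finally show ?thesis using higher_deriv_mult[OF hf(1) q(1), of 0 n] by (simp add: a_def c_def)
  qed
  have ac: "a 0 = 0" "a 1 = 1" "c 0 = 1" by (simp_all add: a_def c_def hf q)
  have a2: "a 2 = - 2 * c 1"
    using leib[of 2] ac by (simp add: numeral_eq_Suc add_eq_0_iff)
  have a3: "a 3 = 6 * c 1 ^ 2 - 3 * c 2"
    using leib[of 3] ac a2
    by (simp add: numeral_eq_Suc algebra_simps add_eq_0_iff)
  have "a 4 + (4 * a 3 * c 1 + 6 * a 2 * c 2 + 4 * c 3) = 0"
    using leib[of 4] ac by (simp add: numeral_eq_Suc algebra_simps)
  then have "a 4 = - (4 * a 3 * c 1 + 6 * a 2 * c 2 + 4 * c 3)"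
    by (simp only: eq_neg_iff_add_eq_0)
  then have a4: "a 4 = - 24 * c 1 ^ 3 + 24 * c 1 * c 2 - 4 * c 3"
    unfolding a2 a3 by (simp add: power2_eq_square power3_eq_cube algebra_simps)
  have "deriv (schwarzian f) 0 = a 4 - 4 * a 2 * a 3 + 3 * a 2 ^ 3"
    unfolding a_def using holomorphic_injective_imp_regular[OF hf(1) _ hf(4)] hf
    by (intro deriv_schwarzian[of f "ball 0 1"]) auto
  also have "\<dots> = - 4 * c 3"
    unfolding a2 a3 a4 by (simp add: power2_eq_square power3_eq_cube algebra_simps)
  finally show ?thesis by (simp add: c_def)
qed

section \<open>Shape of the image of a small circle under \<open>1 / f\<close>\<close>

text \<open>Second-order Taylor formula for \<open>q\<close>, divided by \<open>z\<close>. On the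
  compact disc of radius \<open>1/2\<close> the third derivative is bounded, which provides
  \<open>K\<close>.\<close>

lemma reciprocal_expansion_bound:
  assumes q: "q holomorphic_on ball 0 1" "q 0 = 1"
  obtains K where "0 \<le> K" 
    "\<And>z. z \<noteq> 0 \<Longrightarrow> cmod z \<le> 1 / 2 \<Longrightarrow> 
       cmod (q z / z - deriv q 0 - 1 / z - (deriv ^^ 2) q 0 / 2 * z) \<le> K * (cmod z)\<^sup>2"
proof -
  define D where "D = (\<lambda>i. (deriv ^^ i) q)"
  have sub: "cball 0 (1/2) \<subseteq> ball (0::complex) 1" by auto
  have "compact (D 3 ` cball 0 (1/2))"
    unfolding D_def
    by (intro compact_continuous_image holomorphic_on_imp_continuous_on 
          holomorphic_on_subset[OF holomorphic_higher_deriv[OF q(1)] sub]) auto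
  then obtain K where K: "\<And>z. z \<in> cball 0 (1/2) \<Longrightarrow> cmod (D 3 z) \<le> K"
    by (meson compact_imp_bounded bounded_iff imageI)
  have "0 \<le> K" using K[of 0] norm_ge_zero[of "D 3 0"] by (simp del: norm_ge_zero)
  moreover have "cmod (q z / z - deriv q 0 - 1 / z - (deriv ^^ 2) q 0 / 2 * z) \<le> K * (cmod z)\<^sup>2"
    if z: "z \<noteq> 0" "cmod z \<le> 1 / 2" for z
  proof -
    have "cmod (D 0 z - (\<Sum>i\<le>2. D i 0 * (z - 0) ^ i / fact i)) \<le> K * cmod (z - 0) ^ Suc 2 / fact 2"
    proof (rule complex_Taylor[where S = "cball 0 (1/2)"])
      fix i and x :: complex assume "x \<in> cball 0 (1 / 2)"
      then show "(D i has_field_derivative D (Suc i) x) (at x within cball 0 (1 / 2))"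
        unfolding D_def using has_field_derivative_higher_deriv[OF q(1), of x i] sub
        by (auto intro: has_field_derivative_at_within)
    qed (use z K in \<open>auto simp: numeral_eq_Suc\<close>)
    also have "(\<Sum>i\<le>2. D i 0 * (z - 0) ^ i / fact i) = 1 + deriv q 0 * z + (deriv ^^ 2) q 0 / 2 * z\<^sup>2"
      by (simp add: D_def numeral_2_eq_2 q)
    also have "D 0 z - \<dots> = z * (q z / z - deriv q 0 - 1 / z - (deriv ^^ 2) q 0 / 2 * z)"
      using z by (simp add: D_def field_simps power2_eq_square)
    also have "K * cmod (z - 0) ^ Suc 2 / fact 2 \<le> cmod z * (K * (cmod z)\<^sup>2)"
      using mult_nonneg_nonneg[OF \<open>0 \<le> K\<close>, of "cmod z ^ 3"]
      by (simp add: power2_eq_square power3_eq_cube mult_ac)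
    finally show ?thesis using z by (simp add: norm_mult del: times_divide_eq_left)
  qed
  ultimately show thesis by (rule that)
qed

text \<open>Since \<open>(cmod z)\<^sup>2 * cnj (1 / z) = z\<close>, the conjugate of the leading
  term \<open>1 / z\<close> cancels the term \<open>b * z\<close>. What remains besides
  \<open>1 / z\<close> is of order \<open>(cmod z)\<^sup>2\<close>.\<close>

lemma reciprocal_ellipse_bound:
  assumes q: "q holomorphic_on ball 0 1" "q 0 = 1"
  obtains K where "0 \<le> K" 
    "\<And>z. z \<noteq> 0 \<Longrightarrow> cmod z \<le> 1 / 2 \<Longrightarrow> 
       cmod ((q z / z - deriv q 0) - ((deriv ^^ 2) q 0 / 2 * of_real ((cmod z)\<^sup>2)) * cnj (q z / z - deriv q 0))
         \<le> 1 / cmod z + K * (cmod z)\<^sup>2"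
proof -
  define b where "b = (deriv ^^ 2) q 0 / 2"
  obtain K where K: "0 \<le> K" "\<And>z. z \<noteq> 0 \<Longrightarrow> cmod z \<le> 1 / 2 \<Longrightarrow> 
       cmod (q z / z - deriv q 0 - 1 / z - b * z) \<le> K * (cmod z)\<^sup>2"
    using reciprocal_expansion_bound[OF q] unfolding b_def by metis
  have "cmod ((q z / z - deriv q 0) - (b * of_real ((cmod z)\<^sup>2)) * cnj (q z / z - deriv q 0))
         \<le> 1 / cmod z + (K + cmod b * (cmod b + K)) * (cmod z)\<^sup>2" if z: "z \<noteq> 0" "cmod z \<le> 1 / 2" for z
  proof -
    define R where "R = q z / z - deriv q 0 - 1 / z - b * z"
    have R: "cmod R \<le> K * (cmod z)\<^sup>2" using K(2)[OF z] by (simp add: R_def)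
    have "(cmod z)\<^sup>2 \<le> 1" using z by (simp add: power_le_one)
    \<comment> \<open>This cruder bound is enough where \<open>R\<close> occurs conjugated, because
      the factor \<open>w\<close> there already has modulus \<open>(cmod z)\<^sup>2\<close>.\<close>
    then have RK: "cmod R \<le> K" using R K(1) mult_left_le[of "(cmod z)\<^sup>2" K] by linarith
    define w where "w = complex_of_real ((cmod z)\<^sup>2)"
    have wz: "w * cnj (1 / z) = z"
      using z by (simp add: w_def complex_norm_square del: of_real_power)
    have "(1 / z + b * z + R) - (b * w) * cnj (1 / z + b * z + R) =
        1 / z + b * z + R - b * (w * cnj (1 / z)) - b * w * (cnj b * cnj z + cnj R)"
      by (simp add: algebra_simps)
    also have "\<dots> = 1 / z + (R - b * w * (cnj b * cnj z + cnj R))"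
      unfolding wz by simp
    also have "cmod \<dots> \<le> cmod (1 / z) + (cmod R + cmod (b * w * (cnj b * cnj z + cnj R)))"
      by (intro norm_triangle_le add_left_mono norm_triangle_ineq4)
    also have "cmod (b * w * (cnj b * cnj z + cnj R)) = cmod b * (cmod z)\<^sup>2 * cmod (cnj b * cnj z + cnj R)"
      by (simp add: norm_mult norm_power w_def)
    also have "cmod (cnj b * cnj z + cnj R) \<le> cmod b + K"
    proof -
      have "cmod (cnj b * cnj z) \<le> cmod b"
        using z by (simp add: norm_mult mult_left_le)
      then show ?thesis using RK norm_triangle_ineq[of "cnj b * cnj z" "cnj R"] by simp
    qed
    finally have "cmod ((1 / z + b * z + R) - (b * w) * cnj (1 / z + b * z + R))
        \<le> cmod (1 / z) + (K * (cmod z)\<^sup>2 + cmod b * (cmod z)\<^sup>2 * (cmod b + K))"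
      using R by (simp add: mult_left_mono)
    moreover have "1 / z + b * z + R = q z / z - deriv q 0" by (simp add: R_def)
    ultimately have "cmod ((q z / z - deriv q 0) - (b * w) * cnj (q z / z - deriv q 0))
        \<le> cmod (1 / z) + (K * (cmod z)\<^sup>2 + cmod b * (cmod z)\<^sup>2 * (cmod b + K))"
      by (simp only:)
    also have "\<dots> = 1 / cmod z + (K + cmod b * (cmod b + K)) * (cmod z)\<^sup>2"
      by (simp add: norm_divide algebra_simps)
    finally show ?thesis unfolding w_def .
  qed
  then show thesis using K(1) by (intro that[of "K + cmod b * (cmod b + K)"]) (auto simp: b_def)
qed

section \<open>Comparison of areas and the coefficient bound\<close>

text \<open>The twisted image of the annulus between the radii \<open>e\<close> and \<open>r\<close>
  lies in a disc of radius \<open>Q\<close>. Its area is bounded from below by keeping only the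
  frequencies 0 and 3 on each circle. Here \<open>e\<close> is a radius, not Euler's number.\<close>

lemma class_S_area_inequality:
  assumes f: "f \<in> class_S" and q: "q holomorphic_on ball 0 1" "q 0 = 1"
    and fq: "\<And>z. z \<in> ball 0 1 \<Longrightarrow> f z * q z = z"
    and e: "0 < e" "e < r" "r < 1" and k: "cmod k < 1"
    and bd: "\<And>z. cmod z = e \<Longrightarrow> cmod ((q z / z - b) - k * cnj (q z / z - b)) \<le> Q"
  shows "(1 - (cmod k)\<^sup>2) * (1 / e\<^sup>2 - 1 / r\<^sup>2 + 2 * (cmod ((deriv ^^ 3) q 0 / 6))\<^sup>2 * (r ^ 4 - e ^ 4)) \<le> Q\<^sup>2"
proof -
  have hf: "f holomorphic_on ball 0 1" "f 0 = 0" "inj_on f (ball 0 1)"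
    using f by (auto simp: class_S_def class_A_def)
  have phi: "q z / z = 1 / f z" if "z \<in> ball 0 1" "z \<noteq> 0" for z
  proof -
    have "f z \<noteq> 0" using fq[OF that(1)] that(2) by auto
    then show ?thesis using fq[OF that(1)] that(2) by (simp add: frac_eq_eq mult.commute)
  qed
  \<comment> \<open>In the logarithmic coordinate \<open>q z / z\<close> has derivative
    \<open>m z / z\<close>. Passing from \<open>q\<close> to \<open>m\<close> multiplies the
    coefficient of \<open>z ^ n\<close> by \<open>n - 1\<close>, hence the factor 2 in
    \<open>m3\<close>.\<close>
  define m where "m = (\<lambda>z. z * deriv q z - q z)"
  have m: "m holomorphic_on ball 0 1"
    unfolding m_def by (intro holomorphic_intros q) auto
  have m0: "m 0 = -1" by (simp add: m_def q)
  define Y where "Y = (cmod ((deriv ^^ 3) q 0 / 6))\<^sup>2"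
  have m3: "(deriv ^^ 3) m 0 / fact 3 = 2 * ((deriv ^^ 3) q 0 / 6)"
  proof -
    have dq: "deriv q holomorphic_on ball 0 1" by (intro holomorphic_intros q) auto
    have "(deriv ^^ 3) m 0 = (deriv ^^ 3) (\<lambda>z. z * deriv q z) 0 - (deriv ^^ 3) q 0"
      unfolding m_def by (rule higher_deriv_diff[of _ "ball 0 1"]) (auto intro!: holomorphic_intros q)
    also have "(deriv ^^ 3) (\<lambda>z. z * deriv q z) 0 = 3 * (deriv ^^ 3) q 0"
      using higher_deriv_mult[of "\<lambda>z. z" "ball 0 1" "deriv q" 0 3] dq
      by (simp add: higher_deriv_ident numeral_eq_Suc)
    finally show ?thesis by (simp add: fact_numeral)
  qed
  define S where "S = {w. Re w < 0}"
  have S: "open S" unfolding S_def by (simp add: open_halfspace_Re_lt)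
  define G where "G = (\<lambda>w. q (exp w) / exp w)"
  have expS: "exp w \<in> ball 0 1" if "w \<in> S" for w
    using that by (simp add: S_def)
  have dG: "(G has_field_derivative m (exp w) / exp w) (at w)" if "w \<in> S" for w
  proof -
    have "(q has_field_derivative deriv q (exp w)) (at (exp w))"
      by (rule holomorphic_derivI[OF q(1) _ expS[OF that]]) auto
    from DERIV_chain2[OF this DERIV_exp[of w]]
    have "((\<lambda>w. q (exp w)) has_field_derivative deriv q (exp w) * exp w) (at w)" .
    from DERIV_divide[OF this DERIV_exp[of w]]
    have "(G has_field_derivative
        (deriv q (exp w) * exp w * exp w - q (exp w) * exp w) / (exp w * exp w)) (at w)"
      by (simp add: G_def)
    also have "(deriv q (exp w) * exp w * exp w - q (exp w) * exp w) / (exp w * exp w) = m (exp w) / exp w"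
      by (simp add: m_def field_simps)
    finally show ?thesis .
  qed
  have holG: "G holomorphic_on S"
    using dG S by (auto simp: holomorphic_on_open)
  have Gphi: "G w = 1 / f (exp w)" if "w \<in> S" for w
    using phi[OF expS[OF that]] by (simp add: G_def)
  have "ln r < 0" using e by simp
  then have lnr: "s < ln r \<Longrightarrow> s < 0" "s \<le> ln r \<Longrightarrow> s < 0" for s by linarith+
  have "(1 - (cmod k)\<^sup>2) * integral {ln e..ln r} (\<lambda>s. integral {0..2*pi} (\<lambda>t. (cmod (deriv G (Complex s t)))\<^sup>2))
           \<le> pi * Q\<^sup>2"
  proof (rule area_le_if_twisted_image_in_cball[OF holG S])
    show "Complex s t \<in> S" if "s \<in> {ln e..ln r}" for s t
      using that by (auto simp: S_def intro: lnr)
    \<comment> \<open>The open rectangle corresponds under \<open>exp\<close> to the annulus slit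
      along the positive axis, where both \<open>exp\<close> and \<open>f\<close> are
      injective.\<close>
    show "inj_on G {z. Re z \<in> {ln e<..<ln r} \<and> Im z \<in> {0<..<2*pi}}"
    proof (rule inj_onI; clarsimp)
      fix w z assume wz: "G w = G z" "ln e < Re w" "Re w < ln r" "0 < Im w" "Im w < 2 * pi"
        "ln e < Re z" "Re z < ln r" "0 < Im z" "Im z < 2 * pi"
      have "w \<in> S" "z \<in> S" using wz by (simp_all add: S_def lnr(1))
      then have "f (exp w) = f (exp z)" using wz(1) Gphi by simp
      then have "exp w = exp z"
        by (rule inj_onD[OF hf(3) _ expS[OF \<open>w \<in> S\<close>] expS[OF \<open>z \<in> S\<close>]])
      moreover have "\<bar>Im w - Im z\<bar> < 2 * pi" using wz(4,5,8,9) by linarith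
      ultimately show "w = z" using exp_complex_eqI by blast
    qed
    \<comment> \<open>The centre is the twisted image of \<open>b\<close>, so this is the bound on
      the circle carried outwards by the convexity argument.\<close>
    show "cmod (G (Complex s t) - k * cnj (G (Complex s t)) - (b - k * cnj b)) \<le> Q"
      if "s \<in> {ln e<..<ln r}" for s t
    proof -
      have s: "Complex s t \<in> S" using that by (auto simp: S_def intro: lnr)
      have "e < exp s" using that e by (metis exp_less_mono exp_ln greaterThanLessThan_iff)
      have "cmod ((1 / f (exp (Complex s t)) - b) - k * cnj (1 / f (exp (Complex s t)) - b)) \<le> Q"
      proof (rule ellipse_bound_outside_disc[OF hf e(1)])
        show "e < cmod (exp (Complex s t))" using \<open>e < exp s\<close> by simp
        show "cmod (exp (Complex s t)) < 1" using expS[OF s] by simp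
        fix z assume z: "cmod z = e"
        then have "q z / z = 1 / f z" using e by (intro phi) auto
        then show "cmod ((1 / f z - b) - k * cnj (1 / f z - b)) \<le> Q" using bd[OF z] by (simp only:)
      qed
      then show ?thesis by (simp add: Gphi[OF s] algebra_simps)
    qed
    have "cmod (of_real e) = e" using e by simp
    then show "0 \<le> Q" by (rule order_trans[OF norm_ge_zero bd])
  qed (use k in auto)
  moreover have "2 * pi * ((1 / e\<^sup>2 - 1 / r\<^sup>2) / 2 + Y * (r ^ 4 - e ^ 4)) 
      \<le> integral {ln e..ln r} (\<lambda>s. integral {0..2*pi} (\<lambda>t. (cmod (deriv G (Complex s t)))\<^sup>2))"
  proof (rule has_integral_le)
    \<comment> \<open>The integrand is Bessel's bound on the circle of radius \<open>exp s\<close>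
      times \<open>exp (- 2 * s)\<close>, the squared modulus of
      \<open>1 / exp (Complex s t)\<close>.\<close>
    have "((\<lambda>s. 2 * pi * (exp (- 2 * s) + 4 * Y * exp (4 * s))) has_integral
        (2 * pi * (- exp (- 2 * ln r) / 2 + Y * exp (4 * ln r)) - 2 * pi * (- exp (- 2 * ln e) / 2 + Y * exp (4 * ln e)))) {ln e..ln r}"
      using e by (intro fundamental_theorem_of_calculus)
        (auto intro!: derivative_eq_intros simp: has_real_derivative_iff_has_vector_derivative[symmetric] algebra_simps)
    moreover have "exp (- 2 * ln x) = 1 / x\<^sup>2" "exp (4 * ln x) = x ^ 4" if "x > 0" for x :: real
      using that by (simp_all add: exp_minus exp_of_nat_mult[of 2, simplified] exp_of_nat_mult[of 4, simplified] divide_inverse)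
    then have "2 * pi * (- exp (- 2 * ln r) / 2 + Y * exp (4 * ln r)) - 2 * pi * (- exp (- 2 * ln e) / 2 + Y * exp (4 * ln e))
        = 2 * pi * (- (1 / r\<^sup>2) / 2 + Y * r ^ 4) - 2 * pi * (- (1 / e\<^sup>2) / 2 + Y * e ^ 4)"
      using e by simp
    moreover have "\<dots> = 2 * pi * ((1 / e\<^sup>2 - 1 / r\<^sup>2) / 2 + Y * (r ^ 4 - e ^ 4))"
      by (simp add: right_diff_distrib distrib_left diff_divide_distrib)
    ultimately show "((\<lambda>s. 2 * pi * (exp (- 2 * s) + 4 * Y * exp (4 * s))) has_integral
        2 * pi * ((1 / e\<^sup>2 - 1 / r\<^sup>2) / 2 + Y * (r ^ 4 - e ^ 4))) {ln e..ln r}"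
      by (simp only:)
    have "continuous_on (cbox (ln e, 0) (ln r, 2*pi)) (\<lambda>p. deriv G (Complex (fst p) (snd p)))"
      by (intro continuous_on_compose2[OF holomorphic_on_imp_continuous_on[OF holomorphic_deriv[OF holG S]]])
         (auto intro!: continuous_intros simp: cbox_Pair_eq S_def intro: lnr)
    then have "continuous_on (cbox (ln e, 0) (ln r, 2*pi)) (\<lambda>p. (cmod (deriv G (Complex (fst p) (snd p))))\<^sup>2)"
      by (intro continuous_intros)
    from integral_integrable_2dim[OF this]
    show "((\<lambda>s. integral {0..2*pi} (\<lambda>t. (cmod (deriv G (Complex s t)))\<^sup>2)) has_integral
       integral {ln e..ln r} (\<lambda>s. integral {0..2*pi} (\<lambda>t. (cmod (deriv G (Complex s t)))\<^sup>2))) {ln e..ln r}"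
      by (auto intro: integrable_integral)
    fix s assume s: "s \<in> {ln e..ln r}"
    have s0: "s < 0" using s by (auto intro: lnr)
    have es: "exp (Complex s t) = exp s * cis t" for t
      by (simp add: exp_eq_polar)
    have dn: "(cmod (deriv G (Complex s t)))\<^sup>2 = exp (- 2 * s) * (cmod (m (exp s * cis t)))\<^sup>2" for t
    proof -
      have "deriv G (Complex s t) = m (exp s * cis t) / (exp s * cis t)"
        using DERIV_imp_deriv[OF dG[of "Complex s t"]] s0 by (simp add: es S_def)
      then have "cmod (deriv G (Complex s t)) = exp (- s) * cmod (m (exp s * cis t))"
        by (simp add: norm_divide norm_mult exp_minus) (simp add: divide_inverse)
      then show ?thesis by (simp add: power_mult_distrib flip: exp_double)
    qed
    have "2 * pi * ((cmod (m 0))\<^sup>2 + (cmod ((deriv ^^ 3) m 0 / fact 3))\<^sup>2 * exp s ^ (2 * 3))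
        \<le> integral {0..2*pi} (\<lambda>t. (cmod (m (exp s * cis t)))\<^sup>2)"
      using s0 by (intro circle_mean_square_ge[OF m]) auto
    also have "(cmod ((deriv ^^ 3) m 0 / fact 3))\<^sup>2 = 4 * Y"
      unfolding m3 norm_mult Y_def by (simp add: power_mult_distrib power_divide)
    finally have "exp (- 2 * s) * (2 * pi * (1 + 4 * Y * exp s ^ 6))
        \<le> exp (- 2 * s) * integral {0..2*pi} (\<lambda>t. (cmod (m (exp s * cis t)))\<^sup>2)"
      by (intro mult_left_mono) (auto simp: m0)
    also have "\<dots> = integral {0..2*pi} (\<lambda>t. (cmod (deriv G (Complex s t)))\<^sup>2)"
      by (simp add: dn)
    also have "exp (- 2 * s) * (2 * pi * (1 + 4 * Y * exp s ^ 6)) = 2 * pi * (exp (- 2 * s) + 4 * Y * exp (4 * s))"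
    proof -
      have "exp (- 2 * s) * exp s ^ 6 = exp (4 * s)"
        by (simp flip: exp_of_nat_mult exp_add)
      then show ?thesis by (simp add: algebra_simps)
    qed
    finally show "2 * pi * (exp (- 2 * s) + 4 * Y * exp (4 * s))
        \<le> integral {0..2*pi} (\<lambda>t. (cmod (deriv G (Complex s t)))\<^sup>2)" .
  qed
  moreover have "0 \<le> 1 - (cmod k)\<^sup>2" using k by (simp add: power_le_one)
  ultimately have "(1 - (cmod k)\<^sup>2) * (2 * pi * ((1 / e\<^sup>2 - 1 / r\<^sup>2) / 2 + Y * (r ^ 4 - e ^ 4))) \<le> pi * Q\<^sup>2"
    by (meson mult_left_mono order_trans)
  also have "2 * pi * ((1 / e\<^sup>2 - 1 / r\<^sup>2) / 2 + Y * (r ^ 4 - e ^ 4))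
      = pi * (1 / e\<^sup>2 - 1 / r\<^sup>2 + 2 * Y * (r ^ 4 - e ^ 4))"
    by (simp add: distrib_left)
  finally have "pi * ((1 - (cmod k)\<^sup>2) * (1 / e\<^sup>2 - 1 / r\<^sup>2 + 2 * Y * (r ^ 4 - e ^ 4))) \<le> pi * Q\<^sup>2"
    by (simp only: mult.left_commute)
  then show ?thesis by (simp add: Y_def)
qed

text \<open>With \<open>k = b * e\<^sup>2\<close> and \<open>Q = 1 / e + K * e\<^sup>2\<close> the
  divergent terms \<open>1 / e\<^sup>2\<close> on both sides of the area inequality cancel. First
  \<open>e\<close> tends to 0 with \<open>r\<close> fixed, then \<open>r\<close> tends to 1.\<close>

lemma class_S_reciprocal_coeff_bound:
  assumes f: "f \<in> class_S" and q: "q holomorphic_on ball 0 1" "q 0 = 1"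
    and fq: "\<And>z. z \<in> ball 0 1 \<Longrightarrow> f z * q z = z"
  shows "2 * (cmod ((deriv ^^ 3) q 0 / 6))\<^sup>2 \<le> 1"
proof -
  define Y where "Y = (cmod ((deriv ^^ 3) q 0 / 6))\<^sup>2"
  define b where "b = (deriv ^^ 2) q 0 / 2"
  define B where "B = (cmod b)\<^sup>2"
  obtain K where K: "0 \<le> K" 
    "\<And>z. z \<noteq> 0 \<Longrightarrow> cmod z \<le> 1 / 2 \<Longrightarrow> 
       cmod ((q z / z - deriv q 0) - (b * of_real ((cmod z)\<^sup>2)) * cnj (q z / z - deriv q 0))
         \<le> 1 / cmod z + K * (cmod z)\<^sup>2"
    using reciprocal_ellipse_bound[OF q] unfolding b_def by metis
  have bound: "2 * Y * r ^ 4 - 1 / r\<^sup>2 \<le> 0" if r: "0 < r" "r < 1" for r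
  proof (rule tendsto_le[OF trivial_limit_at_right_real])
    show "((\<lambda>e. (1 - B * e ^ 4) * (2 * Y * (r ^ 4 - e ^ 4) - 1 / r\<^sup>2) - B * e\<^sup>2) \<longlongrightarrow> 2 * Y * r ^ 4 - 1 / r\<^sup>2) (at_right 0)"
      by (auto intro!: tendsto_eq_intros)
    show "((\<lambda>e. 2 * K * e + K\<^sup>2 * e ^ 4) \<longlongrightarrow> 0) (at_right 0)"
      by (auto intro!: tendsto_eq_intros)
    have "((\<lambda>e. cmod b * e\<^sup>2) \<longlongrightarrow> 0) (at_right 0)"
      by (auto intro!: tendsto_eq_intros)
    \<comment> \<open>Ensures \<open>cmod k < 1\<close> for small \<open>e\<close>, as the area
      inequality demands.\<close>
    then have "eventually (\<lambda>e. cmod b * e\<^sup>2 < 1) (at_right 0)"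
      by (rule order_tendstoD) simp
    moreover have "eventually (\<lambda>e. e \<in> {0<..<min r (1/2)}) (at_right 0)"
      using r by (intro eventually_at_right_real) auto
    ultimately show "eventually (\<lambda>e. (1 - B * e ^ 4) * (2 * Y * (r ^ 4 - e ^ 4) - 1 / r\<^sup>2) - B * e\<^sup>2 
        \<le> 2 * K * e + K\<^sup>2 * e ^ 4) (at_right 0)"
    proof eventually_elim
      case (elim e)
      then have e: "0 < e" "e < r" "e \<le> 1 / 2" by auto
      have k2: "(cmod (b * of_real (e\<^sup>2)))\<^sup>2 = B * e ^ 4"
        by (simp add: B_def norm_mult norm_power power_mult_distrib)
      have "(1 - (cmod (b * of_real (e\<^sup>2)))\<^sup>2) * (1 / e\<^sup>2 - 1 / r\<^sup>2 + 2 * Y * (r ^ 4 - e ^ 4))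
           \<le> (1 / e + K * e\<^sup>2)\<^sup>2"
        unfolding Y_def
      proof (rule class_S_area_inequality[OF f q fq e(1,2) r(2)])
        show "cmod (b * of_real (e\<^sup>2)) < 1" using elim(1) by (simp add: norm_mult norm_power)
        show "cmod ((q z / z - deriv q 0) - b * of_real (e\<^sup>2) * cnj (q z / z - deriv q 0)) \<le> 1 / e + K * e\<^sup>2"
          if "cmod z = e" for z
          using K(2)[of z] that e by auto
      qed
      then have "(1 - B * e ^ 4) * (1 / e\<^sup>2 - 1 / r\<^sup>2 + 2 * Y * (r ^ 4 - e ^ 4)) \<le> (1 / e + K * e\<^sup>2)\<^sup>2"
        unfolding k2 .
      moreover have "(1 / e + K * e\<^sup>2)\<^sup>2 = 1 / e\<^sup>2 + 2 * K * e + K\<^sup>2 * e ^ 4"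
        using e(1) by (simp add: power2_eq_square field_simps power4_eq_xxxx)
      moreover have "(1 - B * e ^ 4) * (1 / e\<^sup>2 - 1 / r\<^sup>2 + 2 * Y * (r ^ 4 - e ^ 4))
         = (1 - B * e ^ 4) * (2 * Y * (r ^ 4 - e ^ 4) - 1 / r\<^sup>2) + (1 / e\<^sup>2 - B * e\<^sup>2)"
      proof -
        have "(1 - B * e ^ 4) * (1 / e\<^sup>2) = 1 / e\<^sup>2 - B * e\<^sup>2"
          using e(1) by (simp add: power2_eq_square field_simps power4_eq_xxxx)
        moreover have "(1 - B * e ^ 4) * (1 / e\<^sup>2 - 1 / r\<^sup>2 + 2 * Y * (r ^ 4 - e ^ 4))
           = (1 - B * e ^ 4) * (2 * Y * (r ^ 4 - e ^ 4) - 1 / r\<^sup>2) + (1 - B * e ^ 4) * (1 / e\<^sup>2)"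
          by (simp only: distrib_left[symmetric]) simp
        ultimately show ?thesis by simp
      qed
      ultimately show ?case by linarith
    qed
  qed
  have "2 * Y \<le> 1"
  proof (rule tendsto_le[OF trivial_limit_at_left_real])
    show "((\<lambda>r. 2 * Y * r ^ 4) \<longlongrightarrow> 2 * Y) (at_left 1)"
      by (auto intro!: tendsto_eq_intros)
    show "((\<lambda>r::real. 1 / r\<^sup>2) \<longlongrightarrow> 1) (at_left 1)"
      by (auto intro!: tendsto_eq_intros)
    have "eventually (\<lambda>r::real. r \<in> {0<..<1}) (at_left 1)"
      by (intro eventually_at_left_real) auto
    then show "eventually (\<lambda>r. 2 * Y * r ^ 4 \<le> 1 / r\<^sup>2) (at_left 1)"
      by eventually_elim (use bound in fastforce)
  qed
  then show ?thesis by (simp add: Y_def)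
qed

theorem theorem5:
  fixes f :: "complex \<Rightarrow> complex"
  assumes "f \<in> class_S"
  shows "cmod (deriv (schwarzian f) 0) \<le> 64 / 5 * sqrt 3 \<and>
         22.17025 \<le> 64 / 5 * sqrt 3 \<and> 64 / 5 * sqrt 3 < 22.17026"
proof -
  obtain q where q: "q holomorphic_on ball 0 1" "q 0 = 1"
    and fq: "\<And>z. z \<in> ball 0 1 \<Longrightarrow> f z * q z = z"
    using class_S_reciprocal[OF assms] by metis
  \<comment> \<open>The divisor \<open>12.8\<close> is \<open>64 / 5\<close>.\<close>
  have s1: "22.17025 / 12.8 \<le> sqrt (3::real)"
    by (rule real_le_rsqrt) (simp add: power2_eq_square)
  have s2: "sqrt (3::real) < 22.17026 / 12.8"
    by (rule real_less_lsqrt) (simp_all add: power2_eq_square)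
  define x where "x = cmod ((deriv ^^ 3) q 0 / 6)"
  \<comment> \<open>The coefficient bound gives \<open>x\<^sup>2 \<le> 1 / 2\<close>, and
    \<open>4 / 5\<close> is a convenient rational above its root: \<open>24 * 4 / 5 = 19.2\<close>
    is still below \<open>22.17025\<close>.\<close>
  have "x\<^sup>2 \<le> (4 / 5)\<^sup>2"
    using class_S_reciprocal_coeff_bound[OF assms q fq] by (simp add: x_def power2_eq_square)
  then have "x \<le> 4 / 5" by (rule power2_le_imp_le) simp
  moreover have "cmod (deriv (schwarzian f) 0) = 24 * x"
  proof -
    have "deriv (schwarzian f) 0 = - 4 * (deriv ^^ 3) q 0"
      using assms q fq by (rule deriv_schwarzian_eq_reciprocal_coeff)
    then show ?thesis unfolding x_def by (simp add: norm_mult norm_divide)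
  qed
  ultimately show ?thesis using s1 s2 by simp
qed

end
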